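(* Let $p$ be a prime number and let $m,d\ge 1$ be integers. The number $\Psi_d(p^m)$ of polyfunctions in $G_d(\mathbb{Z}_{p^m})$ is given by $$\Psi_d(p^m)=\prod_{\substack{\boldsymbol{k}\in\mathbb{N}_0^d\\ e_p(\boldsymbol{k})<m}}p^{\,m-e_p(\boldsymbol{k})}.$$
   Context: $\mathbb{Z}_n=\mathbb{Z}/n\mathbb{Z}$ and $\mathbb{N}_0=\{0,1,2,\dots\}$. For a commutative ring $R$ with unit element, $G_d(R)$ is the ring of functions $f:R^d\to R$ for which there is a polynomial $q\in R[x_1,\dots,x_d]$ with $f(\boldsymbol{x})=q(\boldsymbol{x})$ for all $\boldsymbol{x}\in R^d$ (polyfunctions in $d$ variables), with pointwise operations; $\Psi_d(n):=|G_d(\mathbb{Z}_n)|$. For $\boldsymbol{k}=(k_1,\dots,k_d)\in\mathbb{N}_0^d$ put $\boldsymbol{k}!:=\prod_{i=1}^d k_i!$ and $e_p(\boldsymbol{k}):=\max\{x\in\mathbb{N}_0: p^x\mid \boldsymbol{k}!\}$. *)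

theory Defs
  imports "HOL-Algebra.Indexed_Polynomials" "HOL-Number_Theory.Residues"
begin

context cring
begin

text \<open>Points of \<open>R\<^sup>d\<close> are extensional functions on \<open>{..<d}\<close>, and functions on \<open>R\<^sup>d\<close> are
  extensional functions on that set of points, so that distinct HOL functions are
  distinct as mathematical functions and cardinalities are the intended ones.\<close>

definition affine_space :: "nat \<Rightarrow> (nat \<Rightarrow> 'a) set" where
  "affine_space d = {..<d} \<rightarrow>\<^sub>E carrier R"

text \<open>The polynomial ring in the variables \<open>x\<^sub>i\<close>, \<open>i < d\<close>, is the set
  \<open>carrier R [\<X>\<^bsub>{..<d}\<^esub>]\<close>: a polynomial maps each monomial, given as a
  multiset of variables, to its coefficient. All such maps have finite support
  (lemma \<open>indexed_pset_finite_support\<close>).\<close>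

definition mpoly_eval :: "nat \<Rightarrow> (nat multiset \<Rightarrow> 'a) \<Rightarrow> (nat \<Rightarrow> 'a) \<Rightarrow> 'a" where
  "mpoly_eval d q x =
     (\<Oplus>\<mu> \<in> {\<mu>. q \<mu> \<noteq> \<zero>}. q \<mu> \<otimes> (\<Otimes>i \<in> {..<d}. x i [^] count \<mu> i))"

definition polyfunctions :: "nat \<Rightarrow> ((nat \<Rightarrow> 'a) \<Rightarrow> 'a) set" where
  "polyfunctions d =
     {f \<in> affine_space d \<rightarrow>\<^sub>E carrier R.
        \<exists>q \<in> (carrier R [\<X>\<^bsub>{..<d}\<^esub>]). \<forall>x \<in> affine_space d. f x = mpoly_eval d q x}"

definition polyfunction_ring :: "nat \<Rightarrow> ((nat \<Rightarrow> 'a) \<Rightarrow> 'a) ring" where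
  "polyfunction_ring d =
     \<lparr>carrier = polyfunctions d,
      monoid.mult = (\<lambda>f g. \<lambda>x \<in> affine_space d. f x \<otimes> g x),
      one = (\<lambda>x \<in> affine_space d. \<one>),
      zero = (\<lambda>x \<in> affine_space d. \<zero>),
      add = (\<lambda>f g. \<lambda>x \<in> affine_space d. f x \<oplus> g x)\<rparr>"

lemma indexed_pset_finite_support:
  assumes "q \<in> (carrier R [\<X>\<^bsub>I\<^esub>])"
  shows "finite {\<mu>. q \<mu> \<noteq> \<zero>}" and "q \<mu> \<in> carrier R" and "q \<mu> \<noteq> \<zero> \<Longrightarrow> set_mset \<mu> \<subseteq> I"
proof -
  show "q \<mu> \<in> carrier R"
    using indexed_pset_in_carrier[OF subset_refl assms] by (simp add: carrier_coeff_def)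
  show "finite {\<mu>. q \<mu> \<noteq> \<zero>}"
    using assms
  proof induction
    case (indexed_const k)
    have "{\<mu>. indexed_const k \<mu> \<noteq> \<zero>} \<subseteq> {{#}}"
      by (auto simp: indexed_const_def)
    then show ?case
      by (rule finite_subset) simp
  next
    case (indexed_padd P Q)
    have "{\<mu>. (P \<Oplus> Q) \<mu> \<noteq> \<zero>} \<subseteq> {\<mu>. P \<mu> \<noteq> \<zero>} \<union> {\<mu>. Q \<mu> \<noteq> \<zero>}"
      by (auto simp: indexed_padd_def)
    then show ?case
      by (rule finite_subset) (simp add: indexed_padd.IH)
  next
    case (indexed_pmult P i)
    have "{\<mu>. (P \<Otimes> i) \<mu> \<noteq> \<zero>} \<subseteq> (\<lambda>\<mu>. add_mset i \<mu>) ` {\<mu>. P \<mu> \<noteq> \<zero>}"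
    proof
      fix \<mu> assume "\<mu> \<in> {\<mu>. (P \<Otimes> i) \<mu> \<noteq> \<zero>}"
      then have "i \<in># \<mu>" "P (\<mu> - {#i#}) \<noteq> \<zero>"
        by (auto simp: indexed_pmult_def split: if_splits)
      then show "\<mu> \<in> (\<lambda>\<mu>. add_mset i \<mu>) ` {\<mu>. P \<mu> \<noteq> \<zero>}"
        by (intro image_eqI[of _ _ "\<mu> - {#i#}"]) auto
    qed
    then show ?case
      by (rule finite_subset) (simp add: indexed_pmult.IH)
  qed
  show "set_mset \<mu> \<subseteq> I" if "q \<mu> \<noteq> \<zero>"
    using assms that
  proof (induction arbitrary: \<mu>)
    case (indexed_const k)
    then show ?case
      by (auto simp: indexed_const_def split: if_splits)
  next
    case (indexed_padd P Q)
    then have "P \<mu> \<noteq> \<zero> \<or> Q \<mu> \<noteq> \<zero>"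
      by (auto simp: indexed_padd_def)
    then show ?case
      using indexed_padd.IH by blast
  next
    case (indexed_pmult P i)
    then have "i \<in># \<mu>" "P (\<mu> - {#i#}) \<noteq> \<zero>"
      by (auto simp: indexed_pmult_def split: if_splits)
    then have "set_mset (\<mu> - {#i#}) \<subseteq> I"
      using indexed_pmult.IH by blast
    with \<open>i \<in># \<mu>\<close> \<open>i \<in> I\<close> show ?case
      by (metis insert_DiffM insert_subset set_mset_add_mset_insert)
  qed
qed

end

text \<open>Note that \<open>residue_ring n\<close> is a ring only for \<open>n > 1\<close>: its unit is \<open>1\<close>
  and its carrier is \<open>{0..n - 1}\<close>.\<close>

definition Psi :: "nat \<Rightarrow> nat \<Rightarrow> nat" where
  "Psi d n = order (cring.polyfunction_ring (residue_ring (int n)) d)"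

definition multi_indices :: "nat \<Rightarrow> (nat \<Rightarrow> nat) set" where
  "multi_indices d = {..<d} \<rightarrow>\<^sub>E UNIV"

definition multi_fact :: "nat \<Rightarrow> (nat \<Rightarrow> nat) \<Rightarrow> nat" where
  "multi_fact d k = (\<Prod>i<d. fact (k i))"

definition fact_exponent :: "nat \<Rightarrow> nat \<Rightarrow> (nat \<Rightarrow> nat) \<Rightarrow> nat" where
  "fact_exponent p d k = Max {x. p ^ x dvd multi_fact d k}"

lemma multi_fact_nonzero: "multi_fact d k \<noteq> 0"
  by (simp add: multi_fact_def)

lemma fact_exponent_eq_multiplicity:
  assumes "prime p"
  shows "fact_exponent p d k = multiplicity p (multi_fact d k)"
proof -
  have "finite {x. p ^ x dvd multi_fact d k}"
    using multi_fact_nonzero not_prime_unit assms by (metis finite_divisor_powers)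
  then show ?thesis
    by (simp add: fact_exponent_def multiplicity_def)
qed

lemma finite_fact_exponent_less:
  assumes "prime p"
  shows "finite {k \<in> multi_indices d. fact_exponent p d k < m}"
proof (rule finite_subset)
  have pow: "p ^ j dvd (fact (j * p) :: nat)" for j
  proof (induction j)
    case (Suc j)
    have "p dvd (fact p :: nat)"
      using assms prime_gt_0_nat[of p] by (simp add: dvd_fact)
    then have "p * p ^ j dvd fact p * (fact (j * p) :: nat)"
      using Suc by (rule mult_dvd_mono)
    also have "\<dots> dvd (fact (p + j * p) :: nat)"
      by (rule fact_fact_dvd_fact)
    finally show ?case by simp
  qed simp
  show "{k \<in> multi_indices d. fact_exponent p d k < m} \<subseteq> {..<d} \<rightarrow>\<^sub>E {..<m * p}"
  proof
    fix k assume k: "k \<in> {k \<in> multi_indices d. fact_exponent p d k < m}"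
    have "k i < m * p" if "i < d" for i
    proof (rule ccontr)
      assume "\<not> k i < m * p"
      then have "(fact (m * p) :: nat) dvd fact (k i)"
        by (intro fact_dvd) simp
      moreover have "(fact (k i) :: nat) dvd multi_fact d k"
        unfolding multi_fact_def using that dvd_prodI[of "{..<d}" i "\<lambda>i. fact (k i) :: nat"] by simp
      ultimately have "p ^ m dvd multi_fact d k"
        using pow[of m] by (meson dvd_trans)
      then have "m \<le> multiplicity p (multi_fact d k)"
        using multi_fact_nonzero not_prime_unit assms by (metis multiplicity_geI)
      with k show False
        using fact_exponent_eq_multiplicity[OF assms] by simp
    qed
    with k show "k \<in> {..<d} \<rightarrow>\<^sub>E {..<m * p}"
      by (auto simp: multi_indices_def PiE_iff)
  qed
  show "finite ({..<d} \<rightarrow>\<^sub>E {..<m * p})"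
    by (intro finite_PiE) auto
qed

end

theory Submission
  imports Defs
begin

text \<open>
  The formula is the prime power case of a count for every modulus \<open>n > 1\<close>. Write
  \<open>B\<^sub>k(x) = \<Prod>\<^sub>i x\<^sub>i (x\<^sub>i - 1) \<cdots> (x\<^sub>i - k\<^sub>i + 1)\<close>. Every monomial is an integer combination
  of the \<open>B\<^sub>k\<close>, and at points with nonnegative coordinates \<open>B\<^sub>k\<close> is \<open>k!\<close> times a product of
  binomial coefficients. This has two consequences modulo \<open>n\<close>.

  Upper bound: the coefficient \<open>c\<^sub>k\<close> of \<open>B\<^sub>k\<close> matters only through \<open>c\<^sub>k k!\<close> modulo \<open>n\<close>, that is,
  modulo \<open>n / gcd(n, k!)\<close>. In particular \<open>B\<^sub>k\<close> vanishes identically as soon as some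
  \<open>k\<^sub>i \<ge> n\<close>, so that only the finitely many \<open>k\<close> in the box \<open>[0, n)\<^sup>d\<close> are needed
  (\<open>polynomial_mod_iff_falling_expandable\<close>).

  Lower bound: \<open>B\<^sub>l(k) = 0\<close> unless \<open>l \<le> k\<close> in every coordinate, and \<open>B\<^sub>k(k) = k!\<close>. Evaluating
  at the points of the box is therefore a triangular system, and a combination that vanishes
  modulo \<open>n\<close> at all of them has \<open>n\<close> dividing every \<open>c\<^sub>k k!\<close> (\<open>falling_sum_vanishes_imp\<close>).

  Hence polyfunctions correspond to choices of one residue modulo \<open>n / gcd(n, k!)\<close> for each
  \<open>k\<close> in the box, and their number is the product of these moduli (\<open>Psi_eq_prod\<close>). For
  \<open>n = p\<^sup>m\<close> the modulus is \<open>p\<close> to the power \<open>m - e\<^sub>p(k)\<close>, truncated at \<open>0\<close>, and the indices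
  with \<open>e\<^sub>p(k) \<ge> m\<close> contribute the factor \<open>1\<close>.
\<close>

section \<open>Products of falling factorials\<close>

definition falling_basis :: "nat \<Rightarrow> (nat \<Rightarrow> nat) \<Rightarrow> (nat \<Rightarrow> int) \<Rightarrow> int" where
  "falling_basis d k x = (\<Prod>i<d. \<Prod>j<k i. x i - int j)"

text \<open>The library identity between falling factorials and binomial coefficients needs a field,
  so the proof passes through the reals. For \<open>n < k\<close> both sides are \<open>0\<close>.\<close>

lemma falling_factorial_eq_fact_choose:
  "(\<Prod>j<k. int n - int j) = int (fact k * (n choose k))"
proof -
  have "real_of_int (\<Prod>j<k. int n - int j) = (\<Prod>j = 0..<k. real n - real j)"
    by (simp add: atLeast0LessThan)
  also have "\<dots> = fact k * (real n gchoose k)"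
    by (simp add: gbinomial_mult_fact)
  also have "\<dots> = real_of_int (int (fact k * (n choose k)))"
    by (simp add: binomial_gbinomial)
  finally show ?thesis
    by linarith
qed

text \<open>All arithmetic of the basis is in this factorization: it gives divisibility by \<open>k!\<close>
  and the triangular shape of the values at multi-indices. The hypothesis is restricted to
  \<open>i < d\<close> because extensional points are undefined outside that range.\<close>

lemma falling_basis_eq_fact_choose:
  assumes "\<And>i. i < d \<Longrightarrow> x i = int (a i)"
  shows "falling_basis d k x = int (multi_fact d k) * (\<Prod>i<d. int (a i choose k i))"
proof -
  have "falling_basis d k x = (\<Prod>i<d. int (fact (k i) * (a i choose k i)))"
    unfolding falling_basis_def falling_factorial_eq_fact_choose[symmetric]
    by (intro prod.cong) (simp_all add: assms)
  then show ?thesis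
    by (simp add: multi_fact_def prod.distrib)
qed

text \<open>From \<open>x\<^sub>i = (x\<^sub>i - k\<^sub>i) + k\<^sub>i\<close>: the first summand is exactly the next factor of the falling
  factorial. This recurrence turns monomials into combinations of the basis without Stirling
  numbers.\<close>

lemma var_times_falling_basis:
  assumes "i < d"
  shows "x i * falling_basis d k x =
    falling_basis d (k(i := Suc (k i))) x + int (k i) * falling_basis d k x"
proof -
  let ?rest = "\<Prod>l\<in>{..<d} - {i}. \<Prod>j<k l. x l - int j"
  have "falling_basis d k x = (\<Prod>j<k i. x i - int j) * ?rest"
    unfolding falling_basis_def using assms by (subst prod.remove[of _ i]) auto
  moreover have "falling_basis d (k(i := Suc (k i))) x = (\<Prod>j<Suc (k i). x i - int j) * ?rest"
    unfolding falling_basis_def using assms by (subst prod.remove[of _ i]) auto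
  ultimately show ?thesis
    by (simp add: algebra_simps)
qed

text \<open>The number \<open>n\<close> is itself a factor of \<open>k\<^sub>i!\<close> once \<open>k\<^sub>i \<ge> n\<close>. This is what confines
  expansions modulo \<open>n\<close> to a finite box.\<close>

lemma dvd_multi_fact:
  assumes "i < d" and "0 < n" and "n \<le> k i"
  shows "n dvd multi_fact d k"
proof -
  have "n dvd fact (k i)"
    using assms by (intro dvd_fact) auto
  also have "fact (k i) dvd multi_fact d k"
    unfolding multi_fact_def using assms(1) dvd_prodI[of "{..<d}" i "\<lambda>i. fact (k i) :: nat"] by simp
  finally show ?thesis .
qed

lemma monomial_add_mset:
  fixes x :: "nat \<Rightarrow> int"
  assumes "j < d"
  shows "(\<Prod>i<d. x i ^ count (add_mset j \<mu>) i) = x j * (\<Prod>i<d. x i ^ count \<mu> i)"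
proof -
  have "(\<Prod>i<d. x i ^ count (add_mset j \<mu>) i)
      = (\<Prod>i<d. (if i = j then x j else 1) * x i ^ count \<mu> i)"
    by (intro prod.cong) auto
  also have "\<dots> = (\<Prod>i<d. if i = j then x j else 1) * (\<Prod>i<d. x i ^ count \<mu> i)"
    by (rule prod.distrib)
  finally show ?thesis
    using assms by simp
qed

context residues
begin

section \<open>Polynomial functions as integer functions up to congruence\<close>

lemma affine_space_eq: "affine_space d = {..<d} \<rightarrow>\<^sub>E {0..m - 1}"
  by (simp add: affine_space_def res_carrier_eq)

lemma affine_space_point_nonneg: "x \<in> affine_space d \<Longrightarrow> i < d \<Longrightarrow> 0 \<le> x i"
  by (auto simp: affine_space_eq PiE_iff)

lemma mod_carrier: "a \<in> carrier R \<Longrightarrow> a mod m = a"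
  by (simp add: res_carrier_eq)

text \<open>Evaluation in the residue ring becomes an ordinary integer sum. Allowing any finite
  \<open>S\<close> that contains the support makes it possible to compare polynomials whose supports
  differ, since cancellation modulo \<open>m\<close> can shrink the support of a sum.\<close>

lemma mpoly_eval_cong_sum:
  assumes q: "q \<in> (carrier R [\<X>\<^bsub>{..<d}\<^esub>])" and x: "x \<in> affine_space d"
    and S: "finite S" "{\<mu>. q \<mu> \<noteq> \<zero>} \<subseteq> S"
  shows "[mpoly_eval d q x = (\<Sum>\<mu>\<in>S. q \<mu> * (\<Prod>i<d. x i ^ count \<mu> i))] (mod m)"
proof -
  have xc: "x i mod m = x i" if "i < d" for i
    using x that by (intro mod_carrier) (auto simp: affine_space_def)
  have pw: "x i [^] (n :: nat) = x i ^ n mod m" if "i < d" for i n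
    using pow_cong[of "x i" n] xc[OF that] by simp
  have pr: "(\<Otimes>i \<in> {..<d}. x i [^] count \<mu> i) = (\<Prod>i<d. x i ^ count \<mu> i) mod m" for \<mu>
  proof -
    have "(\<Otimes>i \<in> {..<d}. x i [^] count \<mu> i) = (\<Otimes>i \<in> {..<d}. x i ^ count \<mu> i mod m)"
      using x by (intro finprod_cong) (auto simp: pw simp_implies_def)
    then show ?thesis
      by (simp add: prod_cong)
  qed
  have tm: "q \<mu> \<otimes> (\<Otimes>i \<in> {..<d}. x i [^] count \<mu> i)
      = (q \<mu> * (\<Prod>i<d. x i ^ count \<mu> i)) mod m" for \<mu>
    by (simp add: pr res_mult_eq mod_mult_right_eq)
  have "mpoly_eval d q x =
      (\<Oplus>\<mu> \<in> {\<mu>. q \<mu> \<noteq> \<zero>}. (q \<mu> * (\<Prod>i<d. x i ^ count \<mu> i)) mod m)"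
    unfolding mpoly_eval_def tm ..
  also have "\<dots> = (\<Sum>\<mu> \<in> {\<mu>. q \<mu> \<noteq> \<zero>}. q \<mu> * (\<Prod>i<d. x i ^ count \<mu> i)) mod m"
    using indexed_pset_finite_support(1)[OF q] by (rule sum_cong)
  also have "(\<Sum>\<mu> \<in> {\<mu>. q \<mu> \<noteq> \<zero>}. q \<mu> * (\<Prod>i<d. x i ^ count \<mu> i))
      = (\<Sum>\<mu> \<in> S. q \<mu> * (\<Prod>i<d. x i ^ count \<mu> i))"
    using S by (intro sum.mono_neutral_left) (auto simp: res_zero_eq)
  finally show ?thesis
    by (simp add: cong_def)
qed

text \<open>Integer-valued functions, compared only on \<open>affine_space d\<close> and only modulo \<open>m\<close>, spare
  the reductions and the extensionality that genuine elements of \<open>polyfunctions\<close> carry.\<close>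

definition polynomial_mod :: "nat \<Rightarrow> ((nat \<Rightarrow> int) \<Rightarrow> int) \<Rightarrow> bool" where
  "polynomial_mod d f \<longleftrightarrow> (\<exists>q \<in> (carrier R [\<X>\<^bsub>{..<d}\<^esub>]).
     \<forall>x \<in> affine_space d. [f x = mpoly_eval d q x] (mod m))"

lemma polynomial_mod_cong:
  assumes "polynomial_mod d f" and "\<And>x. x \<in> affine_space d \<Longrightarrow> [g x = f x] (mod m)"
  shows "polynomial_mod d g"
  using assms unfolding polynomial_mod_def by (meson cong_trans)

lemma polynomial_mod_const: "polynomial_mod d (\<lambda>_. c)"
proof -
  have q: "indexed_const (c mod m) \<in> (carrier R [\<X>\<^bsub>{..<d}\<^esub>])"
    by (rule indexed_pset.indexed_const) simp
  have "[c = mpoly_eval d (indexed_const (c mod m)) x] (mod m)" if x: "x \<in> affine_space d" for x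
  proof -
    have "[mpoly_eval d (indexed_const (c mod m)) x =
        (\<Sum>\<mu>\<in>{{#}}. indexed_const (c mod m) \<mu> * (\<Prod>i<d. x i ^ count \<mu> i))] (mod m)"
      by (rule mpoly_eval_cong_sum[OF q x]) (auto simp: indexed_const_def)
    then show ?thesis
      by (simp add: indexed_const_def cong_def)
  qed
  with q show ?thesis
    unfolding polynomial_mod_def by blast
qed

lemma polynomial_mod_add:
  assumes "polynomial_mod d f" and "polynomial_mod d g"
  shows "polynomial_mod d (\<lambda>x. f x + g x)"
proof -
  from assms obtain P Q where
    P: "P \<in> (carrier R [\<X>\<^bsub>{..<d}\<^esub>])" "\<And>x. x \<in> affine_space d \<Longrightarrow> [f x = mpoly_eval d P x] (mod m)"
    and Q: "Q \<in> (carrier R [\<X>\<^bsub>{..<d}\<^esub>])" "\<And>x. x \<in> affine_space d \<Longrightarrow> [g x = mpoly_eval d Q x] (mod m)"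
    unfolding polynomial_mod_def by blast
  have PQ: "P \<Oplus> Q \<in> (carrier R [\<X>\<^bsub>{..<d}\<^esub>])"
    using P(1) Q(1) by (rule indexed_pset.indexed_padd)
  let ?S = "{\<mu>. P \<mu> \<noteq> \<zero>} \<union> {\<mu>. Q \<mu> \<noteq> \<zero>}"
  let ?M = "\<lambda>x \<mu>. \<Prod>i<d. (x i :: int) ^ count \<mu> i"
  have S: "finite ?S"
    using indexed_pset_finite_support(1)[OF P(1)] indexed_pset_finite_support(1)[OF Q(1)] by simp
  have "[f x + g x = mpoly_eval d (P \<Oplus> Q) x] (mod m)" if x: "x \<in> affine_space d" for x
  proof -
    have "[f x + g x = mpoly_eval d P x + mpoly_eval d Q x] (mod m)"
      using P(2) Q(2) x by (intro cong_add)
    also have "[mpoly_eval d P x + mpoly_eval d Q x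
        = (\<Sum>\<mu>\<in>?S. P \<mu> * ?M x \<mu>) + (\<Sum>\<mu>\<in>?S. Q \<mu> * ?M x \<mu>)] (mod m)"
      by (intro cong_add mpoly_eval_cong_sum P(1) Q(1) x S) auto
    also have "(\<Sum>\<mu>\<in>?S. P \<mu> * ?M x \<mu>) + (\<Sum>\<mu>\<in>?S. Q \<mu> * ?M x \<mu>)
        = (\<Sum>\<mu>\<in>?S. (P \<mu> + Q \<mu>) * ?M x \<mu>)"
      by (simp add: sum.distrib distrib_right)
    also have "[\<dots> = (\<Sum>\<mu>\<in>?S. (P \<Oplus> Q) \<mu> * ?M x \<mu>)] (mod m)"
      by (intro cong_sum cong_mult) (auto simp: indexed_padd_def res_add_eq cong_def)
    also have "[(\<Sum>\<mu>\<in>?S. (P \<Oplus> Q) \<mu> * ?M x \<mu>) = mpoly_eval d (P \<Oplus> Q) x] (mod m)"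
      by (rule cong_sym, rule mpoly_eval_cong_sum[OF PQ x S])
         (auto simp: indexed_padd_def res_add_eq res_zero_eq)
    finally show ?thesis .
  qed
  with PQ show ?thesis
    unfolding polynomial_mod_def by blast
qed

lemma polynomial_mod_var_mult:
  assumes "polynomial_mod d f" and j: "j < d"
  shows "polynomial_mod d (\<lambda>x. x j * f x)"
proof -
  from assms obtain P where
    P: "P \<in> (carrier R [\<X>\<^bsub>{..<d}\<^esub>])" "\<And>x. x \<in> affine_space d \<Longrightarrow> [f x = mpoly_eval d P x] (mod m)"
    unfolding polynomial_mod_def by blast
  have PX: "P \<Otimes> j \<in> (carrier R [\<X>\<^bsub>{..<d}\<^esub>])"
    using P(1) j by (intro indexed_pset.indexed_pmult) auto
  let ?S = "{\<mu>. P \<mu> \<noteq> \<zero>}"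
  let ?M = "\<lambda>x \<mu>. \<Prod>i<d. (x i :: int) ^ count \<mu> i"
  have S: "finite ?S"
    using indexed_pset_finite_support(1)[OF P(1)] .
  have "[x j * f x = mpoly_eval d (P \<Otimes> j) x] (mod m)" if x: "x \<in> affine_space d" for x
  proof -
    \<comment> \<open>Multiplication by a variable shifts the support injectively.\<close>
    have sub: "{\<mu>. (P \<Otimes> j) \<mu> \<noteq> \<zero>} \<subseteq> add_mset j ` ?S"
    proof
      fix \<mu> assume "\<mu> \<in> {\<mu>. (P \<Otimes> j) \<mu> \<noteq> \<zero>}"
      then have "j \<in># \<mu>" "P (\<mu> - {#j#}) \<noteq> \<zero>"
        by (auto simp: indexed_pmult_def split: if_splits)
      then show "\<mu> \<in> add_mset j ` ?S"
        by (intro image_eqI[of _ _ "\<mu> - {#j#}"]) auto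
    qed
    have "[x j * f x = x j * mpoly_eval d P x] (mod m)"
      using P(2) x by (intro cong_mult) auto
    also have "[x j * mpoly_eval d P x = x j * (\<Sum>\<mu>\<in>?S. P \<mu> * ?M x \<mu>)] (mod m)"
      by (intro cong_mult cong_refl mpoly_eval_cong_sum P(1) x S) auto
    also have "x j * (\<Sum>\<mu>\<in>?S. P \<mu> * ?M x \<mu>) = (\<Sum>\<mu>\<in>?S. P \<mu> * ?M x (add_mset j \<mu>))"
      by (simp only: monomial_add_mset[OF j] sum_distrib_left mult.left_commute)
    also have "\<dots> = (\<Sum>\<mu>\<in>add_mset j ` ?S. (P \<Otimes> j) \<mu> * ?M x \<mu>)"
      by (subst sum.reindex) (auto simp: inj_on_def indexed_pmult_def intro!: sum.cong)
    also have "[\<dots> = mpoly_eval d (P \<Otimes> j) x] (mod m)"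
      by (rule cong_sym, rule mpoly_eval_cong_sum[OF PX x _ sub]) (use S in simp)
    finally show ?thesis .
  qed
  with PX show ?thesis
    unfolding polynomial_mod_def by blast
qed

text \<open>Modulo \<open>m\<close> every scalar is a natural number, so scaling is repeated addition.\<close>

lemma polynomial_mod_scale:
  assumes "polynomial_mod d f"
  shows "polynomial_mod d (\<lambda>x. c * f x)"
proof -
  have "polynomial_mod d (\<lambda>x. int n * f x)" for n
  proof (induction n)
    case 0
    then show ?case using polynomial_mod_const[of d 0] by simp
  next
    case (Suc n)
    from polynomial_mod_add[OF this assms] show ?case
      by (simp add: algebra_simps)
  qed
  from this[of "nat (c mod m)"] show ?thesis
    by (rule polynomial_mod_cong) (use m_gt_one in \<open>simp add: cong_def mod_mult_left_eq\<close>)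
qed

lemma polynomial_mod_sum:
  assumes "finite A" and "\<And>a. a \<in> A \<Longrightarrow> polynomial_mod d (f a)"
  shows "polynomial_mod d (\<lambda>x. \<Sum>a\<in>A. f a x)"
  using assms
proof (induction A)
  case empty
  then show ?case using polynomial_mod_const[of d 0] by simp
next
  case (insert a A)
  then show ?case by (simp add: polynomial_mod_add)
qed

lemma polynomial_mod_falling_basis: "polynomial_mod d (falling_basis d k)"
proof -
  have lin: "polynomial_mod d (\<lambda>x. (x i - int j) * f x)"
    if "polynomial_mod d f" "i < d" for f i j
    using polynomial_mod_add[OF polynomial_mod_var_mult[OF that]
        polynomial_mod_scale[OF that(1), of "- int j"]]
    by (simp add: algebra_simps)
  have fall: "polynomial_mod d (\<lambda>x. (\<Prod>j<n. x i - int j) * f x)"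
    if "polynomial_mod d f" "i < d" for f i n
  proof (induction n)
    case 0
    then show ?case using that by simp
  next
    case (Suc n)
    from lin[OF this that(2), of n] show ?case
      by (simp add: mult_ac)
  qed
  have "polynomial_mod d (\<lambda>x. \<Prod>i<e. \<Prod>j<k i. x i - int j)" if "e \<le> d" for e
    using that
  proof (induction e)
    case 0
    then show ?case using polynomial_mod_const[of d 1] by simp
  next
    case (Suc e)
    then have "polynomial_mod d (\<lambda>x. \<Prod>i<e. \<Prod>j<k i. x i - int j)" "e < d"
      by simp_all
    from fall[OF this, of "k e"] show ?case
      by (simp add: mult.commute)
  qed
  then show ?thesis
    unfolding falling_basis_def by blast
qed

section \<open>Expansion in falling factorials\<close>

definition index_box :: "nat \<Rightarrow> (nat \<Rightarrow> nat) set" where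
  "index_box d = {..<d} \<rightarrow>\<^sub>E {..<nat m}"

lemma finite_index_box: "finite (index_box d)"
  unfolding index_box_def by (intro finite_PiE) auto

definition falling_sum :: "nat \<Rightarrow> ((nat \<Rightarrow> nat) \<Rightarrow> int) \<Rightarrow> (nat \<Rightarrow> int) \<Rightarrow> int" where
  "falling_sum d c x = (\<Sum>k\<in>index_box d. c k * falling_basis d k x)"

lemma multi_fact_dvd_falling_basis:
  assumes "x \<in> affine_space d"
  shows "int (multi_fact d k) dvd falling_basis d k x"
  using falling_basis_eq_fact_choose[of d x "\<lambda>i. nat (x i)"] affine_space_point_nonneg[OF assms]
  by simp

definition falling_expandable :: "nat \<Rightarrow> ((nat \<Rightarrow> int) \<Rightarrow> int) \<Rightarrow> bool" where
  "falling_expandable d f \<longleftrightarrow> (\<exists>c. \<forall>x \<in> affine_space d. [f x = falling_sum d c x] (mod m))"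

lemma falling_expandable_cong:
  assumes "falling_expandable d f" and "\<And>x. x \<in> affine_space d \<Longrightarrow> [g x = f x] (mod m)"
  shows "falling_expandable d g"
  using assms unfolding falling_expandable_def by (meson cong_trans)

text \<open>Indices outside the box have to be covered as well, because the recurrence for
  multiplication by a variable can leave the box; there the basis function vanishes
  modulo \<open>m\<close>.\<close>

lemma falling_expandable_basis:
  assumes "k \<in> multi_indices d"
  shows "falling_expandable d (falling_basis d k)"
proof (cases "k \<in> index_box d")
  case True
  have "falling_sum d (\<lambda>l. if l = k then 1 else 0) x = falling_basis d k x" for x
  proof -
    have "falling_sum d (\<lambda>l. if l = k then 1 else 0) x
        = (\<Sum>l\<in>index_box d. if l = k then falling_basis d l x else 0)"
      unfolding falling_sum_def by (intro sum.cong) auto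
    then show ?thesis
      using True finite_index_box[of d] by simp
  qed
  then show ?thesis
    unfolding falling_expandable_def by (metis cong_refl)
next
  case False
  with assms obtain i where "i < d" "nat m \<le> k i"
    by (auto simp: index_box_def multi_indices_def PiE_iff not_less)
  then have "nat m dvd multi_fact d k"
    using m_gt_one by (intro dvd_multi_fact) auto
  then have "m dvd int (multi_fact d k)"
    using m_gt_one by (simp add: nat_dvd_iff)
  then have "m dvd falling_basis d k x" if "x \<in> affine_space d" for x
    using multi_fact_dvd_falling_basis[OF that] by (rule dvd_trans)
  then have "[falling_basis d k x = falling_sum d (\<lambda>_. 0) x] (mod m)" if "x \<in> affine_space d" for x
    using that by (simp add: falling_sum_def cong_0_iff)
  then show ?thesis
    unfolding falling_expandable_def by blast
qed

lemma falling_expandable_add: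
  assumes "falling_expandable d f" and "falling_expandable d g"
  shows "falling_expandable d (\<lambda>x. f x + g x)"
proof -
  from assms obtain a b where
    "\<And>x. x \<in> affine_space d \<Longrightarrow> [f x = falling_sum d a x] (mod m)"
    "\<And>x. x \<in> affine_space d \<Longrightarrow> [g x = falling_sum d b x] (mod m)"
    unfolding falling_expandable_def by blast
  then have "[f x + g x = falling_sum d (\<lambda>k. a k + b k) x] (mod m)" if "x \<in> affine_space d" for x
    using cong_add that by (force simp: falling_sum_def distrib_right sum.distrib)
  then show ?thesis
    unfolding falling_expandable_def by blast
qed

lemma falling_expandable_scale:
  assumes "falling_expandable d f"
  shows "falling_expandable d (\<lambda>x. r * f x)"
proof -
  from assms obtain a where "\<And>x. x \<in> affine_space d \<Longrightarrow> [f x = falling_sum d a x] (mod m)"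
    unfolding falling_expandable_def by blast
  then have "[r * f x = falling_sum d (\<lambda>k. r * a k) x] (mod m)" if "x \<in> affine_space d" for x
    using cong_scalar_left[of "f x" "falling_sum d a x" m r] that
    by (simp add: falling_sum_def sum_distrib_left mult.assoc)
  then show ?thesis
    unfolding falling_expandable_def by blast
qed

lemma falling_expandable_sum:
  assumes "finite A" and "\<And>a. a \<in> A \<Longrightarrow> falling_expandable d (f a)"
  shows "falling_expandable d (\<lambda>x. \<Sum>a\<in>A. f a x)"
  using assms
proof (induction A)
  case empty
  have "[0 = falling_sum d (\<lambda>_. 0) x] (mod m)" for x
    by (simp add: falling_sum_def)
  then show ?case
    unfolding falling_expandable_def by auto
next
  case (insert a A)
  then show ?case by (simp add: falling_expandable_add)
qed

lemma falling_expandable_var_mult: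
  assumes "falling_expandable d f" and i: "i < d"
  shows "falling_expandable d (\<lambda>x. x i * f x)"
proof -
  from assms obtain c where c: "\<And>x. x \<in> affine_space d \<Longrightarrow> [f x = falling_sum d c x] (mod m)"
    unfolding falling_expandable_def by blast
  have "falling_expandable d
      (\<lambda>x. c k * (falling_basis d (k(i := Suc (k i))) x + int (k i) * falling_basis d k x))"
    if "k \<in> index_box d" for k
  proof -
    have "k \<in> multi_indices d" "k(i := Suc (k i)) \<in> multi_indices d"
      using that i by (auto simp: index_box_def multi_indices_def PiE_iff extensional_def)
    then show ?thesis
      by (intro falling_expandable_scale falling_expandable_add falling_expandable_basis)
  qed
  then have "falling_expandable d (\<lambda>x. \<Sum>k\<in>index_box d.
      c k * (falling_basis d (k(i := Suc (k i))) x + int (k i) * falling_basis d k x))"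
    by (intro falling_expandable_sum finite_index_box)
  then have "falling_expandable d (\<lambda>x. x i * falling_sum d c x)"
    by (simp add: var_times_falling_basis[OF i, symmetric] falling_sum_def sum_distrib_left
        mult.left_commute)
  then show ?thesis
    by (rule falling_expandable_cong) (intro cong_scalar_left c)
qed

lemma falling_expandable_monomial:
  assumes "set_mset \<mu> \<subseteq> {..<d}"
  shows "falling_expandable d (\<lambda>x. \<Prod>i<d. x i ^ count \<mu> i)"
  using assms
proof (induction \<mu>)
  case empty
  have "(\<lambda>i\<in>{..<d}. 0) \<in> multi_indices d"
    by (auto simp: multi_indices_def)
  from falling_expandable_basis[OF this] show ?case
    by (rule falling_expandable_cong) (simp add: falling_basis_def)
next
  case (add j \<mu>)
  then have j: "j < d" by auto
  have "falling_expandable d (\<lambda>x. \<Prod>i<d. x i ^ count \<mu> i)"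
    using add by simp
  from falling_expandable_var_mult[OF this j] show ?case
    by (simp only: monomial_add_mset[OF j])
qed

lemma polynomial_mod_iff_falling_expandable:
  "polynomial_mod d f \<longleftrightarrow> falling_expandable d f"
proof
  assume "polynomial_mod d f"
  then obtain q where q: "q \<in> (carrier R [\<X>\<^bsub>{..<d}\<^esub>])"
    "\<And>x. x \<in> affine_space d \<Longrightarrow> [f x = mpoly_eval d q x] (mod m)"
    unfolding polynomial_mod_def by blast
  let ?S = "{\<mu>. q \<mu> \<noteq> \<zero>}"
  have S: "finite ?S"
    using indexed_pset_finite_support(1)[OF q(1)] .
  have "falling_expandable d (\<lambda>x. \<Sum>\<mu>\<in>?S. q \<mu> * (\<Prod>i<d. x i ^ count \<mu> i))"
    using indexed_pset_finite_support(3)[OF q(1)]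
    by (intro falling_expandable_sum[OF S] falling_expandable_scale falling_expandable_monomial) auto
  then show "falling_expandable d f"
  proof (rule falling_expandable_cong)
    fix x assume x: "x \<in> affine_space d"
    show "[f x = (\<Sum>\<mu>\<in>?S. q \<mu> * (\<Prod>i<d. x i ^ count \<mu> i))] (mod m)"
      using q(2)[OF x] mpoly_eval_cong_sum[OF q(1) x S subset_refl] by (rule cong_trans)
  qed
next
  assume "falling_expandable d f"
  then obtain c where c: "\<And>x. x \<in> affine_space d \<Longrightarrow> [f x = falling_sum d c x] (mod m)"
    unfolding falling_expandable_def by blast
  have "polynomial_mod d (falling_sum d c)"
    unfolding falling_sum_def
    by (intro polynomial_mod_sum finite_index_box polynomial_mod_scale polynomial_mod_falling_basis)
  then show "polynomial_mod d f"
    using c by (rule polynomial_mod_cong)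
qed

section \<open>Uniqueness of the coefficients\<close>

text \<open>Evaluation at the point \<open>k\<close> annihilates the terms whose index is not below \<open>k\<close>; the
  terms strictly below \<open>k\<close> vanish modulo \<open>m\<close> by induction on the total degree, since their
  coefficients times \<open>l!\<close> do. Only \<open>a\<^sub>k k!\<close> is left.\<close>

lemma falling_sum_vanishes_imp:
  assumes zero: "\<And>x. x \<in> affine_space d \<Longrightarrow> m dvd falling_sum d a x"
    and "k \<in> index_box d"
  shows "m dvd a k * int (multi_fact d k)"
  using assms(2)
proof (induction "\<Sum>i<d. k i" arbitrary: k rule: less_induct)
  case less
  define x where "x = (\<lambda>i\<in>{..<d}. int (k i))"
  have x: "x \<in> affine_space d"
  proof -
    have "int (k i) \<le> m - 1" if "i < d" for i
    proof -
      have "k i < nat m"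
        using less.prems that by (auto simp: index_box_def PiE_iff)
      then show ?thesis by linarith
    qed
    then show ?thesis
      by (auto simp: x_def affine_space_eq)
  qed
  have basis: "falling_basis d l x = int (multi_fact d l) * (\<Prod>i<d. int (k i choose l i))" for l
    by (rule falling_basis_eq_fact_choose) (simp add: x_def)
  have other: "m dvd a l * falling_basis d l x" if l: "l \<in> index_box d - {k}" for l
  proof (cases "\<forall>i<d. l i \<le> k i")
    case True
    have "\<exists>i<d. l i \<noteq> k i"
    proof (rule ccontr)
      assume "\<not> (\<exists>i<d. l i \<noteq> k i)"
      then have "l i = k i" if "i \<in> {..<d}" for i
        using that by blast
      moreover have "l \<in> {..<d} \<rightarrow>\<^sub>E {..<nat m}" "k \<in> {..<d} \<rightarrow>\<^sub>E {..<nat m}"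
        using l less.prems by (simp_all add: index_box_def)
      ultimately have "l = k"
        by (metis PiE_ext)
      with l show False by blast
    qed
    then have strict: "\<exists>i\<in>{..<d}. l i < k i"
      using True le_neq_implies_less by blast
    have "(\<Sum>i<d. l i) < (\<Sum>i<d. k i)"
      using True by (intro sum_strict_mono_ex1[OF _ _ strict]) simp_all
    moreover have "l \<in> index_box d"
      using l by blast
    ultimately have "m dvd a l * int (multi_fact d l)"
      by (rule less.hyps)
    then show ?thesis
      unfolding basis mult.assoc[symmetric] by (rule dvd_mult2)
  next
    case False
    then obtain i where "i < d" "k i < l i"
      by (auto simp: not_le)
    then have "int (k i choose l i) = 0"
      by (simp add: binomial_eq_0)
    with \<open>i < d\<close> have "(\<Prod>i<d. int (k i choose l i)) = 0"
      by (intro prod_zero) auto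
    then show ?thesis
      by (simp only: basis mult_zero_right dvd_0_right)
  qed
  have "falling_sum d a x = a k * falling_basis d k x
      + (\<Sum>l\<in>index_box d - {k}. a l * falling_basis d l x)"
    unfolding falling_sum_def by (rule sum.remove[OF finite_index_box less.prems])
  moreover have "m dvd (\<Sum>l\<in>index_box d - {k}. a l * falling_basis d l x)"
    using other by (rule dvd_sum)
  ultimately have "m dvd a k * falling_basis d k x"
    using zero[OF x] by (simp only: dvd_add_left_iff)
  moreover have "falling_basis d k x = int (multi_fact d k)"
    unfolding basis by simp
  ultimately show ?case
    by simp
qed

text \<open>The additive order of \<open>k!\<close> modulo \<open>m\<close>.\<close>

definition coeff_modulus :: "nat \<Rightarrow> (nat \<Rightarrow> nat) \<Rightarrow> int" where
  "coeff_modulus d k = m div gcd m (int (multi_fact d k))"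

lemma coeff_modulus_pos: "0 < coeff_modulus d k"
proof -
  let ?g = "gcd m (int (multi_fact d k))"
  have "0 < ?g" "?g \<le> m"
    using m_gt_one by (auto intro: zdvd_imp_le)
  then show ?thesis
    unfolding coeff_modulus_def by (simp add: pos_imp_zdiv_pos_iff)
qed

lemma coeff_modulus_dvd_iff: "coeff_modulus d k dvd a \<longleftrightarrow> m dvd a * int (multi_fact d k)"
proof -
  let ?g = "gcd m (int (multi_fact d k))"
  have g: "?g \<noteq> 0" using m_gt_one by simp
  have cop: "coprime (m div ?g) (int (multi_fact d k) div ?g)"
    using g by (intro div_gcd_coprime) auto
  have "?g * (m div ?g) = m" "?g * (a * (int (multi_fact d k) div ?g)) = a * int (multi_fact d k)"
    using dvd_mult_div_cancel[of ?g m] dvd_mult_div_cancel[of ?g "int (multi_fact d k)"]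
    by (simp_all only: gcd_dvd1 gcd_dvd2 mult.left_commute[of ?g a])
  then have "m dvd a * int (multi_fact d k)
      \<longleftrightarrow> ?g * (m div ?g) dvd ?g * (a * (int (multi_fact d k) div ?g))"
    by (simp only:)
  also have "\<dots> \<longleftrightarrow> m div ?g dvd a * (int (multi_fact d k) div ?g)"
    using g by (simp only: dvd_mult_cancel_left) simp
  also have "\<dots> \<longleftrightarrow> m div ?g dvd a"
    using cop by (simp add: coprime_dvd_mult_left_iff)
  finally show ?thesis
    by (simp add: coeff_modulus_def)
qed

section \<open>Counting\<close>

text \<open>One representative for each family of coefficient residues; extensionality keeps
  the representatives unique as HOL functions.\<close>

definition reduced_coeffs :: "nat \<Rightarrow> ((nat \<Rightarrow> nat) \<Rightarrow> int) set" where
  "reduced_coeffs d = (\<Pi>\<^sub>E k\<in>index_box d. {0..<coeff_modulus d k})"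

definition falling_function :: "nat \<Rightarrow> ((nat \<Rightarrow> nat) \<Rightarrow> int) \<Rightarrow> (nat \<Rightarrow> int) \<Rightarrow> int" where
  "falling_function d c = (\<lambda>x\<in>affine_space d. falling_sum d c x mod m)"

lemma falling_sum_diff:
  "falling_sum d a x - falling_sum d b x = falling_sum d (\<lambda>k. a k - b k) x"
  by (simp add: falling_sum_def sum_subtractf left_diff_distrib)

text \<open>Changing \<open>c\<^sub>k\<close> by a multiple of \<open>coeff_modulus d k\<close> changes \<open>c\<^sub>k k!\<close>, and hence
  \<open>c\<^sub>k B\<^sub>k(x)\<close>, by a multiple of \<open>m\<close>, because \<open>k!\<close> divides \<open>B\<^sub>k(x)\<close>.\<close>

lemma falling_function_eqI:
  assumes "\<And>k. k \<in> index_box d \<Longrightarrow> [a k = b k] (mod coeff_modulus d k)"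
  shows "falling_function d a = falling_function d b"
proof -
  have "m dvd falling_sum d (\<lambda>k. a k - b k) x" if x: "x \<in> affine_space d" for x
    unfolding falling_sum_def
  proof (rule dvd_sum)
    fix k assume "k \<in> index_box d"
    then have "m dvd (a k - b k) * int (multi_fact d k)"
      using assms by (simp add: coeff_modulus_dvd_iff[symmetric] cong_iff_dvd_diff)
    also have "\<dots> dvd (a k - b k) * falling_basis d k x"
      using multi_fact_dvd_falling_basis[OF x] by (rule mult_dvd_mono[OF dvd_refl])
    finally show "m dvd (a k - b k) * falling_basis d k x" .
  qed
  then have "falling_sum d a x mod m = falling_sum d b x mod m" if "x \<in> affine_space d" for x
    using that by (simp add: mod_eq_dvd_iff falling_sum_diff)
  then show ?thesis
    by (auto simp: falling_function_def)
qed

lemma inj_on_falling_function: "inj_on (falling_function d) (reduced_coeffs d)"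
proof
  fix a b assume a: "a \<in> reduced_coeffs d" and b: "b \<in> reduced_coeffs d"
    and eq: "falling_function d a = falling_function d b"
  have "m dvd falling_sum d (\<lambda>k. a k - b k) x" if "x \<in> affine_space d" for x
    using fun_cong[OF eq, of x] that
    by (simp add: falling_function_def mod_eq_dvd_iff falling_sum_diff)
  then have "coeff_modulus d k dvd a k - b k" if "k \<in> index_box d" for k
    using falling_sum_vanishes_imp[of d "\<lambda>k. a k - b k"] that
    by (simp add: coeff_modulus_dvd_iff)
  then have "a k mod coeff_modulus d k = b k mod coeff_modulus d k" if "k \<in> index_box d" for k
    using that by (simp add: mod_eq_dvd_iff)
  moreover have "a k mod coeff_modulus d k = a k" "b k mod coeff_modulus d k = b k"
    if "k \<in> index_box d" for k
    using a b that by (auto simp: reduced_coeffs_def PiE_iff)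
  ultimately show "a = b"
    using a b unfolding reduced_coeffs_def by (intro PiE_ext) auto
qed

text \<open>Between reduced residues, congruence is equality.\<close>

lemma polyfunctions_eq_polynomial_mod:
  "polyfunctions d = {f \<in> affine_space d \<rightarrow>\<^sub>E carrier R. polynomial_mod d f}"
proof -
  have eval: "mpoly_eval d q x \<in> carrier R"
    if "q \<in> (carrier R [\<X>\<^bsub>{..<d}\<^esub>])" "x \<in> affine_space d" for q x
    using that indexed_pset_finite_support(2) unfolding mpoly_eval_def
    by (intro finsum_closed) (auto simp: affine_space_def intro!: m_closed finprod_closed)
  have "f x = mpoly_eval d q x \<longleftrightarrow> [f x = mpoly_eval d q x] (mod m)"
    if "f \<in> affine_space d \<rightarrow>\<^sub>E carrier R" "q \<in> (carrier R [\<X>\<^bsub>{..<d}\<^esub>])" "x \<in> affine_space d" for f q x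
    using mod_carrier[OF PiE_mem[OF that(1,3)]] mod_carrier[OF eval[OF that(2,3)]]
    by (simp add: cong_def)
  then show ?thesis
    unfolding polyfunctions_def polynomial_mod_def by blast
qed

lemma polyfunctions_eq_image: "polyfunctions d = falling_function d ` reduced_coeffs d"
proof (intro equalityI subsetI)
  fix f assume "f \<in> polyfunctions d"
  then have f: "f \<in> affine_space d \<rightarrow>\<^sub>E carrier R" and "falling_expandable d f"
    by (simp_all add: polyfunctions_eq_polynomial_mod polynomial_mod_iff_falling_expandable)
  then obtain c where c: "\<And>x. x \<in> affine_space d \<Longrightarrow> [f x = falling_sum d c x] (mod m)"
    unfolding falling_expandable_def by blast
  let ?r = "\<lambda>k\<in>index_box d. c k mod coeff_modulus d k"
  have "f x = falling_function d c x" for x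
  proof (cases "x \<in> affine_space d")
    case True
    then show ?thesis
      using c[OF True] mod_carrier[OF PiE_mem[OF f True]]
      by (simp add: falling_function_def cong_def)
  next
    case False
    then show ?thesis
      using f by (auto simp: falling_function_def PiE_iff extensional_def)
  qed
  then have "f = falling_function d c" ..
  also have "\<dots> = falling_function d ?r"
    by (rule falling_function_eqI) (simp add: cong_def)
  finally show "f \<in> falling_function d ` reduced_coeffs d"
    using coeff_modulus_pos by (auto simp: reduced_coeffs_def)
next
  fix f assume "f \<in> falling_function d ` reduced_coeffs d"
  then obtain c where f: "f = falling_function d c"
    by blast
  have "[f x = falling_sum d c x] (mod m)" if "x \<in> affine_space d" for x
    using that by (simp add: f falling_function_def cong_def)
  then have "falling_expandable d f"
    unfolding falling_expandable_def by blast
  moreover have "f \<in> affine_space d \<rightarrow>\<^sub>E carrier R"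
    by (auto simp: f falling_function_def)
  ultimately show "f \<in> polyfunctions d"
    by (simp add: polyfunctions_eq_polynomial_mod polynomial_mod_iff_falling_expandable)
qed

lemma card_polyfunctions:
  "card (polyfunctions d) = (\<Prod>k\<in>index_box d. nat (coeff_modulus d k))"
proof -
  have "card (polyfunctions d) = card (reduced_coeffs d)"
    by (simp add: polyfunctions_eq_image card_image inj_on_falling_function)
  then show ?thesis
    unfolding reduced_coeffs_def by (simp add: card_PiE finite_index_box)
qed

end

lemma Psi_eq_prod:
  assumes "n > 1"
  shows "Psi d n = (\<Prod>k\<in>{..<d} \<rightarrow>\<^sub>E {..<n}. n div gcd n (multi_fact d k))"
proof -
  interpret residues "int n" "residue_ring (int n)"
    using assms by unfold_locales simp_all
  have "nat (coeff_modulus d k) = n div gcd n (multi_fact d k)" for k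
    by (simp add: coeff_modulus_def gcd_int_int_eq flip: zdiv_int)
  then show ?thesis
    using card_polyfunctions[of d]
    by (simp add: Psi_def order_def polyfunction_ring_def index_box_def)
qed

section \<open>Prime powers\<close>

text \<open>Truncated subtraction covers the case that \<open>p ^ m\<close> divides \<open>a\<close>.\<close>

lemma prime_power_div_gcd:
  fixes p :: nat
  assumes "prime p" and "a \<noteq> 0"
  shows "p ^ m div gcd (p ^ m) a = p ^ (m - multiplicity p a)"
proof -
  obtain j where j: "j \<le> m" "gcd (p ^ m) a = p ^ j"
    using assms(1) divides_primepow_nat[of p "gcd (p ^ m) a" m] by auto
  have p: "1 < p" "\<not> is_unit p"
    using assms(1) prime_gt_1_nat not_prime_unit by blast+
  have "i \<le> j \<longleftrightarrow> i \<le> m \<and> i \<le> multiplicity p a" for i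
  proof -
    have "i \<le> j \<longleftrightarrow> p ^ i dvd gcd (p ^ m) a"
      unfolding j(2) using p(1) by (simp add: dvd_power_iff_le)
    also have "\<dots> \<longleftrightarrow> p ^ i dvd p ^ m \<and> p ^ i dvd a"
      by (rule gcd_greatest_iff)
    also have "\<dots> \<longleftrightarrow> i \<le> m \<and> i \<le> multiplicity p a"
      using p by (simp add: dvd_power_iff_le power_dvd_iff_le_multiplicity[OF assms(2) p(2)])
    finally show ?thesis .
  qed
  from this[of j] this[of "min m (multiplicity p a)"] have "j = min m (multiplicity p a)"
    by auto
  then have exponent: "m - multiplicity p a = m - j"
    by auto
  have "p \<noteq> 0"
    using assms(1) by auto
  then show ?thesis
    unfolding j(2) exponent using j(1) by (rule power_diff[symmetric])
qed

theorem proposition26: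
  fixes p m d :: nat
  assumes "prime p" and "m \<ge> 1" and "d \<ge> 1"
  shows "Psi d (p ^ m) =
    (\<Prod>k \<in> {k \<in> multi_indices d. fact_exponent p d k < m}. p ^ (m - fact_exponent p d k))"
proof -
  have p: "\<not> is_unit p"
    using assms(1) not_prime_unit by blast
  have n: "p ^ m > 1"
    using assms prime_gt_1_nat[of p] by (intro one_less_power) auto
  have "Psi d (p ^ m) = (\<Prod>k\<in>{..<d} \<rightarrow>\<^sub>E {..<p ^ m}. p ^ (m - fact_exponent p d k))"
    by (simp only: Psi_eq_prod[OF n] fact_exponent_eq_multiplicity[OF assms(1)]
        prime_power_div_gcd[OF assms(1) multi_fact_nonzero])
  \<comment> \<open>The two index sets differ only in indices of the box with exponent at least \<open>m\<close>, whose factor is \<open>1\<close>.\<close>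
  also have "\<dots> = (\<Prod>k \<in> {k \<in> multi_indices d. fact_exponent p d k < m}. p ^ (m - fact_exponent p d k))"
  proof (rule prod.mono_neutral_right)
    show "finite ({..<d} \<rightarrow>\<^sub>E {..<p ^ m})"
      by (intro finite_PiE) auto
    show "{k \<in> multi_indices d. fact_exponent p d k < m} \<subseteq> {..<d} \<rightarrow>\<^sub>E {..<p ^ m}"
    proof
      fix k assume k: "k \<in> {k \<in> multi_indices d. fact_exponent p d k < m}"
      have "k i < p ^ m" if "i < d" for i
      proof (rule ccontr)
        assume "\<not> k i < p ^ m"
        then have "p ^ m dvd multi_fact d k"
          using n that by (intro dvd_multi_fact[of i]) linarith+
        then have "m \<le> multiplicity p (multi_fact d k)"
          unfolding power_dvd_iff_le_multiplicity[OF multi_fact_nonzero p] .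
        then have "m \<le> fact_exponent p d k"
          by (simp only: fact_exponent_eq_multiplicity[OF assms(1)])
        with k show False by simp
      qed
      with k show "k \<in> {..<d} \<rightarrow>\<^sub>E {..<p ^ m}"
        by (auto simp: multi_indices_def PiE_iff)
    qed
    show "\<forall>k\<in>({..<d} \<rightarrow>\<^sub>E {..<p ^ m}) - {k \<in> multi_indices d. fact_exponent p d k < m}.
        p ^ (m - fact_exponent p d k) = 1"
    proof
      fix k assume k: "k \<in> ({..<d} \<rightarrow>\<^sub>E {..<p ^ m}) - {k \<in> multi_indices d. fact_exponent p d k < m}"
      then have "k \<in> multi_indices d"
        by (simp add: multi_indices_def PiE_iff)
      with k have "m - fact_exponent p d k = 0"
        by simp
      then show "p ^ (m - fact_exponent p d k) = 1"
        by (simp only: power_0)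
    qed
  qed
  finally show ?thesis .
qed

end
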